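(* Let $\Phi\colon\mathcal{M}_N\to\mathcal{B}(\mathcal{H})$ be a completely positive map and let $T=(T_1,\dots,T_N)$ be the left creation operators on $\mathcal{F}_N(\mathcal{H},\Phi)$. Let $w\in\mathbb{F}_N^+$ and $h\in\mathcal{H}$. Then for $1\le i,j\le N$ we have $$T_i^*T_j(w\otimes h)=w\otimes p_{i,j}h.$$
   Context: $\mathcal{H}$ is a Hilbert space, $N\ge2$, $\mathcal{M}_N$ is the algebra of complex $N\times N$ matrices with matrix units $e_{i,j}$, and $p_{i,j}=\Phi(e_{i,j})$. $\mathbb{F}_N^+$ is the free monoid on letters $\{1,\dots,N\}$ with unit $e$ (empty word); $|w|$ is word length. $\mathcal{T}_N(\mathcal{H})$ is the vector space of finite sums $\sum_w w\otimes h_w$, $w\in\mathbb{F}_N^+$, $h_w\in\mathcal{H}$. The form $\langle\cdot,\cdot\rangle_\Phi$ on $\mathcal{T}_N(\mathcal{H})$ is linear in the first variable, conjugate linear in the second, with $\langle e\otimes h,e\otimes h'\rangle_\Phi=\langle h,h'\rangle$; $\langle w\otimes h,w'\otimes h'\rangle_\Phi=0$ if $|w|\ne|w'|$; and $\langle i_1\cdots i_k\otimes h,\,i_1'\cdots i_k'\otimes h'\rangle_\Phi=\langle h,\,p_{i_1i_1'}\cdots p_{i_ki_k'}h'\rangle$ for $k\ge1$. The construction takes as given that this form is positive semi-definite (a theorem of the paper). $\mathcal{N}_\Phi=\{x:\langle x,x\rangle_\Phi=0\}$, and $\mathcal{F}_N(\mathcal{H},\Phi)$ is the Hilbert space completion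 of $\mathcal{T}_N(\mathcal{H})/\mathcal{N}_\Phi$. The left creation operators are the linear transformations (not assumed bounded, defined on the dense image of $\mathcal{T}_N(\mathcal{H})$) given by $T_i(w\otimes h+\mathcal{N}_\Phi)=(iw)\otimes h+\mathcal{N}_\Phi$. Reference to $\mathcal{N}_\Phi$ is suppressed: $w\otimes h$ also denotes its class in $\mathcal{F}_N(\mathcal{H},\Phi)$. *)

theory Defs
  imports "HOL-Analysis.Analysis" "HOL-Library.Poly_Mapping"
begin

subsection \<open>Complex vector spaces and complex Hilbert spaces\<close>

class complex_vector = ab_group_add +
  fixes scaleC :: "complex \<Rightarrow> 'a \<Rightarrow> 'a" (infixr \<open>*\<^sub>C\<close> 75)
  assumes scaleC_add_right: "c *\<^sub>C (x + y) = c *\<^sub>C x + c *\<^sub>C y"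
    and scaleC_add_left: "(c + d) *\<^sub>C x = c *\<^sub>C x + d *\<^sub>C x"
    and scaleC_scaleC: "c *\<^sub>C (d *\<^sub>C x) = (c * d) *\<^sub>C x"
    and scaleC_one: "1 *\<^sub>C x = x"

abbreviation clinear :: "('a::complex_vector \<Rightarrow> 'b::complex_vector) \<Rightarrow> bool"
  where "clinear \<equiv> Vector_Spaces.linear (*\<^sub>C) (*\<^sub>C)"

global_interpretation complex_vector:
  vector_space "scaleC :: complex \<Rightarrow> 'a::complex_vector \<Rightarrow> 'a"
  by unfold_locales (simp_all add: scaleC_add_right scaleC_add_left scaleC_scaleC scaleC_one)

text \<open>The inner product is linear in the first and conjugate linear in the second variable. Its
  real part is the real inner product of \<^class>\<open>real_inner\<close>, so that norm, metric and topology
  are the ones induced by the complex inner product.\<close>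

class complex_hilbert_space = complex_vector + real_inner + complete_space +
  fixes cinner :: "'a \<Rightarrow> 'a \<Rightarrow> complex"
  assumes scaleR_scaleC: "r *\<^sub>R x = complex_of_real r *\<^sub>C x"
    and cinner_commute: "cinner x y = cnj (cinner y x)"
    and cinner_add_left: "cinner (x + y) z = cinner x z + cinner y z"
    and cinner_scaleC_left: "cinner (c *\<^sub>C x) y = c * cinner x y"
    and inner_eq_Re_cinner: "inner x y = Re (cinner x y)"

instantiation complex :: complex_hilbert_space
begin
definition "scaleC c (z::complex) = c * z"
definition "cinner (z::complex) w = z * cnj w"
instance
  by standard
    (auto simp: scaleC_complex_def cinner_complex_def algebra_simps scaleR_conv_of_real
      inner_complex_def)
end

instantiation vec :: (complex_vector, finite) complex_vector
begin
definition "scaleC c (x::'a^'b) = (\<chi> i. c *\<^sub>C x $ i)"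
instance
  by standard
    (auto simp: scaleC_vec_def vec_eq_iff scaleC_add_right scaleC_add_left scaleC_scaleC
      scaleC_one)
end

instantiation vec :: (complex_hilbert_space, finite) complex_hilbert_space
begin
definition "cinner (x::'a^'b) y = (\<Sum>i\<in>UNIV. cinner (x $ i) (y $ i))"
instance
proof
  fix x y z :: "'a^'b" and r :: real and c :: complex
  show "r *\<^sub>R x = complex_of_real r *\<^sub>C x"
    by (simp add: vec_eq_iff scaleC_vec_def scaleR_scaleC)
  show "cinner x y = cnj (cinner y x)"
    unfolding cinner_vec_def cnj_sum by (rule sum.cong[OF refl]) (rule cinner_commute)
  show "cinner (x + y) z = cinner x z + cinner y z"
    by (simp add: cinner_vec_def cinner_add_left sum.distrib)
  show "cinner (c *\<^sub>C x) y = c * cinner x y"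
    by (simp add: cinner_vec_def scaleC_vec_def cinner_scaleC_left sum_distrib_left)
  show "inner x y = Re (cinner x y)"
    by (simp add: cinner_vec_def inner_vec_def inner_eq_Re_cinner)
qed
end

instantiation poly_mapping :: (type, complex_vector) complex_vector
begin
definition "scaleC c (x::'a \<Rightarrow>\<^sub>0 'b) = Poly_Mapping.map ((*\<^sub>C) c) x"
instance
proof -
  have *: "Poly_Mapping.lookup (c *\<^sub>C x) k = c *\<^sub>C Poly_Mapping.lookup x k"
    for c :: complex and x :: "'a \<Rightarrow>\<^sub>0 'b" and k
    by (simp add: scaleC_poly_mapping_def Poly_Mapping.map.rep_eq when_def complex_vector.scale_zero_right)
  show "OFCLASS('a \<Rightarrow>\<^sub>0 'b, complex_vector_class)"
    by standard
      (auto intro!: poly_mapping_eqI simp: * Poly_Mapping.lookup_add scaleC_add_right scaleC_add_left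
        scaleC_scaleC scaleC_one)
qed
end


subsection \<open>Completely positive maps\<close>

definition bounded_clinear :: "('a::complex_hilbert_space \<Rightarrow> 'b::complex_hilbert_space) \<Rightarrow> bool"
  where "bounded_clinear A \<longleftrightarrow> clinear A \<and> (\<exists>K. \<forall>x. norm (A x) \<le> norm x * K)"

text \<open>Positivity of the \<open>k \<times> k\<close> operator matrix \<open>(A a b)\<close>, for \<open>a, b < k\<close>, as an operator on
  the \<open>k\<close>-fold direct sum of the underlying Hilbert space.\<close>

definition positive_op_matrix ::
    "nat \<Rightarrow> (nat \<Rightarrow> nat \<Rightarrow> 'a::complex_hilbert_space \<Rightarrow> 'a) \<Rightarrow> bool"
  where "positive_op_matrix k A \<longleftrightarrow>
    (\<forall>x. (\<Sum>a<k. \<Sum>b<k. cinner (A a b (x b)) (x a)) \<in> \<real>\<^sub>\<ge>\<^sub>0)"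

text \<open>A linear map from the complex \<open>'n \<times> 'n\<close> matrices to the bounded operators on \<open>'h\<close>, all of
  whose amplifications to \<open>k \<times> k\<close> matrices preserve positivity.\<close>

definition completely_positive ::
    "(complex^'n^'n \<Rightarrow> 'h::complex_hilbert_space \<Rightarrow> 'h) \<Rightarrow> bool"
  where "completely_positive \<Phi> \<longleftrightarrow>
    (\<forall>A. bounded_clinear (\<Phi> A)) \<and>
    (\<forall>h. clinear (\<lambda>A. \<Phi> A h)) \<and>
    (\<forall>k A. positive_op_matrix k (\<lambda>a b. (*v) (A a b)) \<longrightarrow>
           positive_op_matrix k (\<lambda>a b. \<Phi> (A a b)))"


subsection \<open>The form and the Fock space\<close>

definition unit_image ::
    "(complex^'n^'n \<Rightarrow> 'h \<Rightarrow> 'h) \<Rightarrow> 'n \<Rightarrow> 'n \<Rightarrow> 'h \<Rightarrow> 'h"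
  where "unit_image \<Phi> i j = \<Phi> (axis i (axis j 1))"

definition word_op ::
    "(complex^'n^'n \<Rightarrow> 'h \<Rightarrow> 'h) \<Rightarrow> 'n list \<Rightarrow> 'n list \<Rightarrow> 'h \<Rightarrow> 'h"
  where "word_op \<Phi> w w' = foldr (\<lambda>(i, j) f. unit_image \<Phi> i j \<circ> f) (zip w w') id"

text \<open>Words are lists over \<open>'n\<close>; the finite sums of elementary tensors \<open>w \<otimes> h\<close> are
  the finitely supported functions from words to \<open>'h\<close>.\<close>

abbreviation tensor :: "'n list \<Rightarrow> 'h::complex_vector \<Rightarrow> 'n list \<Rightarrow>\<^sub>0 'h" (infix \<open>\<otimes>\<close> 71)
  where "w \<otimes> h \<equiv> Poly_Mapping.single w h"

definition fock_form ::
    "(complex^'n^'n \<Rightarrow> 'h::complex_hilbert_space \<Rightarrow> 'h)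
      \<Rightarrow> ('n list \<Rightarrow>\<^sub>0 'h) \<Rightarrow> ('n list \<Rightarrow>\<^sub>0 'h) \<Rightarrow> complex"
  where "fock_form \<Phi> x y =
    (\<Sum>w\<in>Poly_Mapping.keys x. \<Sum>w'\<in>Poly_Mapping.keys y.
       if length w = length w' then
         cinner (Poly_Mapping.lookup x w) (word_op \<Phi> w w' (Poly_Mapping.lookup y w'))
       else 0)"

lemma fock_form_tensor:
  assumes "\<And>A. clinear (\<Phi> A)"
  shows "fock_form \<Phi> (w \<otimes> h) (w' \<otimes> h') =
    (if length w = length w' then cinner h (word_op \<Phi> w w' h') else 0)"
proof -
  have zero_left: "cinner 0 z = 0" for z :: 'b
    using cinner_add_left[of 0 0 z] by simp
  have zero_right: "cinner z 0 = 0" for z :: 'b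
    using cinner_commute[of z 0] by (simp add: zero_left)
  have "\<Phi> A 0 = 0" for A
    using assms[of A] unfolding Vector_Spaces.linear_def by (blast intro: module_hom.zero)
  then have "foldr (\<lambda>(i, j) f. unit_image \<Phi> i j \<circ> f) ps id 0 = 0" for ps
    by (induction ps) (auto simp: unit_image_def)
  then have "word_op \<Phi> w w' 0 = 0"
    by (simp add: word_op_def)
  then show ?thesis
    by (cases "h = 0"; cases "h' = 0") (auto simp: fock_form_def zero_left zero_right)
qed

text \<open>A genuine hypothesis: for completely positive \<open>\<Phi>\<close> it makes the form hermitian and hence
  forces the operators \<open>unit_image \<Phi> i j\<close> to commute, which complete positivity alone does not.\<close>

definition fock_form_psd :: "(complex^'n^'n \<Rightarrow> 'h::complex_hilbert_space \<Rightarrow> 'h) \<Rightarrow> bool"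
  where "fock_form_psd \<Phi> \<longleftrightarrow> (\<forall>x. fock_form \<Phi> x x \<in> \<real>\<^sub>\<ge>\<^sub>0)"

definition fock_null :: "(complex^'n^'n \<Rightarrow> 'h::complex_hilbert_space \<Rightarrow> 'h) \<Rightarrow> ('n list \<Rightarrow>\<^sub>0 'h) set"
  where "fock_null \<Phi> = {x. fock_form \<Phi> x x = 0}"

text \<open>The Hilbert space \<open>'f\<close> is a completion of the quotient by \<^term>\<open>fock_null \<Phi>\<close>, and
  \<open>q\<close> sends \<open>x\<close> to the class of \<open>x\<close>: it induces an isometric embedding of the
  quotient with dense range. This determines the pair \<open>('f, q)\<close> up to a unique unitary.\<close>

definition fock_completion ::
    "(complex^'n^'n \<Rightarrow> 'h::complex_hilbert_space \<Rightarrow> 'h)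
      \<Rightarrow> (('n list \<Rightarrow>\<^sub>0 'h) \<Rightarrow> 'f::complex_hilbert_space) \<Rightarrow> bool"
  where "fock_completion \<Phi> q \<longleftrightarrow>
    clinear q \<and>
    (\<forall>x y. q x = q y \<longleftrightarrow> x - y \<in> fock_null \<Phi>) \<and>
    (\<forall>x y. cinner (q x) (q y) = fock_form \<Phi> x y) \<and>
    closure (range q) = UNIV"


subsection \<open>Creation operators and adjoints\<close>

definition prepend_letter :: "'n \<Rightarrow> ('n list \<Rightarrow>\<^sub>0 'h::complex_vector) \<Rightarrow> 'n list \<Rightarrow>\<^sub>0 'h"
  where "prepend_letter i x = (\<Sum>w\<in>Poly_Mapping.keys x. (i # w) \<otimes> Poly_Mapping.lookup x w)"

text \<open>The left creation operator with domain \<^term>\<open>range q\<close>; outside its domain the value is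
  irrelevant.\<close>

definition creation :: "(('n list \<Rightarrow>\<^sub>0 'h::complex_vector) \<Rightarrow> 'f) \<Rightarrow> 'n \<Rightarrow> 'f \<Rightarrow> 'f"
  where "creation q i u = (THE v. \<exists>x. u = q x \<and> v = q (prepend_letter i x))"

text \<open>The adjoint of a possibly unbounded operator \<open>A\<close> with dense domain \<open>D\<close>.\<close>

definition adjoint_domain ::
    "'f::complex_hilbert_space set \<Rightarrow> ('f \<Rightarrow> 'f) \<Rightarrow> 'f set"
  where "adjoint_domain D A = {y. \<exists>z. \<forall>x\<in>D. cinner (A x) y = cinner x z}"

definition adjoint_op ::
    "'f::complex_hilbert_space set \<Rightarrow> ('f \<Rightarrow> 'f) \<Rightarrow> 'f \<Rightarrow> 'f"
  where "adjoint_op D A y = (THE z. \<forall>x\<in>D. cinner (A x) y = cinner x z)"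

end

theory Submission
  imports Defs
begin

text \<open>
  Write \<open>p i j\<close> for \<^term>\<open>unit_image \<Phi> i j\<close>. Pairing both sides of the claim with an
  elementary tensor \<open>u \<otimes> k\<close>, where \<open>u\<close> and \<open>w\<close> have the same length, shows what has to be proved:
  the left side gives \<open>\<langle>k, p i j (word_op \<Phi> u w h)\<rangle>\<close> because prepending \<open>i\<close> and \<open>j\<close>
  puts \<open>p i j\<close> in front, whereas the right side gives \<open>\<langle>k, word_op \<Phi> u w (p i j h)\<rangle>\<close>. So the
  theorem comes down to showing that the operators \<open>p i j\<close> commute with each other.

  The reason why they commute is that the form is hermitian, being the pullback along \<open>q\<close> of the
  inner product of the Fock space. Its values on words of length one give \<open>(p i j)\<^sup>* = p j i\<close>; on
  words of length two hermitian symmetry therefore says that \<open>p i j \<circ> p k l\<close> equals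
  \<open>(p j i \<circ> p l k)\<^sup>*\<close>, and taking adjoints factorwise reverses the product to
  \<open>p k l \<circ> p i j\<close> (lemma \<open>unit_image_commute\<close>).

  The resulting identity \<open>\<langle>T\<^sub>i x, T\<^sub>j (w \<otimes> h)\<rangle> = \<langle>x, w \<otimes> p i j h\<rangle>\<close> (lemma
  \<open>cinner_prepend_letter\<close>) is used twice. Its right side depends on \<open>x\<close> only through its class,
  and the vectors \<open>T\<^sub>j (w \<otimes> h)\<close> span the range of the creation operators, so the identity shows
  that creation operators are well defined on classes. It is then also the defining
  equation of the adjoint, whose value is unique because the domain is dense.
\<close>

section \<open>Inner products and adjoints\<close>

lemma cinner_zero_left [simp]: "cinner 0 (y::'a::complex_hilbert_space) = 0"
  using cinner_add_left[of 0 0 y] by simp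

lemma cinner_zero_right [simp]: "cinner (x::'a::complex_hilbert_space) 0 = 0"
  by (subst cinner_commute) simp

lemma cinner_diff_left:
  "cinner (x - y) (z::'a::complex_hilbert_space) = cinner x z - cinner y z"
  using cinner_add_left[of "x - y" y z] by (simp add: algebra_simps)

lemma cinner_diff_right:
  "cinner (x::'a::complex_hilbert_space) (y - z) = cinner x y - cinner x z"
  by (metis cinner_commute cinner_diff_left complex_cnj_diff)

lemma cinner_sum_left:
  "cinner (sum f A) (y::'a::complex_hilbert_space) = (\<Sum>a\<in>A. cinner (f a) y)"
  by (induction A rule: infinite_finite_induct) (auto simp: cinner_add_left)

lemma cinner_sum_right:
  "cinner (y::'a::complex_hilbert_space) (sum f A) = (\<Sum>a\<in>A. cinner y (f a))"
  unfolding cinner_commute[of y] cinner_sum_left cnj_sum ..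

lemma cinner_self_eq_zero_iff [simp]:
  "cinner x x = 0 \<longleftrightarrow> (x::'a::complex_hilbert_space) = 0"
  by (metis cinner_zero_left inner_eq_Re_cinner inner_eq_zero_iff zero_complex.sel(1))

lemma cinner_eqI_dense:
  fixes y z :: "'a::complex_hilbert_space"
  assumes dense: "closure D = UNIV" and eq: "\<And>x. x \<in> D \<Longrightarrow> cinner x y = cinner x z"
  shows "y = z"
proof -
  have "D \<subseteq> {x. inner x (y - z) = 0}"
    by (auto simp: inner_eq_Re_cinner cinner_diff_right eq)
  moreover have "closed {x. inner x (y - z) = 0}"
    by (intro closed_Collect_eq continuous_intros)
  ultimately have "closure D \<subseteq> {x. inner x (y - z) = 0}"
    by (rule closure_minimal)
  then have "inner (y - z) (y - z) = 0"
    using dense by blast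
  then show ?thesis
    by simp
qed

lemma adjoint_opI:
  assumes dense: "closure D = UNIV" and adj: "\<And>x. x \<in> D \<Longrightarrow> cinner (A x) y = cinner x z"
  shows "y \<in> adjoint_domain D A" "adjoint_op D A y = z"
proof -
  show "y \<in> adjoint_domain D A"
    using adj by (auto simp: adjoint_domain_def)
  show "adjoint_op D A y = z"
    unfolding adjoint_op_def
  proof (rule the_equality)
    fix z' assume "\<forall>x\<in>D. cinner (A x) y = cinner x z'"
    then show "z' = z"
      by (intro cinner_eqI_dense[OF dense]) (simp add: adj)
  qed (simp add: adj)
qed


section \<open>Commutation of the images of the matrix units\<close>

lemma cinner_tensor:
  assumes "\<And>A. clinear (\<Phi> A)" and "fock_completion \<Phi> q"
  shows "cinner (q (w \<otimes> h)) (q (w' \<otimes> h')) =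
    (if length w = length w' then cinner h (word_op \<Phi> w w' h') else 0)"
  using assms(2) fock_form_tensor[of \<Phi>, OF assms(1)] by (simp add: fock_completion_def)

lemma word_op_Nil [simp]: "word_op \<Phi> [] [] = id"
  by (simp add: word_op_def)

lemma word_op_Cons [simp]:
  "word_op \<Phi> (i # w) (j # w') = unit_image \<Phi> i j \<circ> word_op \<Phi> w w'"
  by (simp add: word_op_def)

text \<open>The inner product of two elementary tensors over one-letter words is
  \<open>\<langle>h, unit_image \<Phi> i j k\<rangle>\<close>, so exchanging them exchanges \<open>i\<close> and \<open>j\<close> along with \<open>h\<close> and \<open>k\<close>.\<close>

lemma cinner_unit_image_left:
  assumes "\<And>A. clinear (\<Phi> A)" and "fock_completion \<Phi> q"
  shows "cinner (unit_image \<Phi> i j h) k = cinner h (unit_image \<Phi> j i k)"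
proof -
  note ct = cinner_tensor[OF assms]
  have "cinner (unit_image \<Phi> i j h) k = cnj (cinner (q ([i] \<otimes> k)) (q ([j] \<otimes> h)))"
    by (subst cinner_commute) (simp add: ct)
  also have "\<dots> = cinner (q ([j] \<otimes> h)) (q ([i] \<otimes> k))"
    by (rule cinner_commute[symmetric])
  also have "\<dots> = cinner h (unit_image \<Phi> j i k)"
    by (simp add: ct)
  finally show ?thesis .
qed

text \<open>Hermitian symmetry on words of length two reverses both indices of each factor but keeps
  the order of the factors; moving the factors across the inner product restores the indices and
  reverses the order.\<close>

lemma unit_image_commute:
  assumes "\<And>A. clinear (\<Phi> A)" and "fock_completion \<Phi> q"
  shows "unit_image \<Phi> i j (unit_image \<Phi> k l h) = unit_image \<Phi> k l (unit_image \<Phi> i j h)"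
proof (rule cinner_eqI_dense)
  note ct = cinner_tensor[OF assms]
  note adj = cinner_unit_image_left[OF assms]
  fix g
  have "cinner g (unit_image \<Phi> i j (unit_image \<Phi> k l h)) =
      cinner (q ([i, k] \<otimes> g)) (q ([j, l] \<otimes> h))"
    by (simp add: ct)
  also have "\<dots> = cnj (cinner (q ([j, l] \<otimes> h)) (q ([i, k] \<otimes> g)))"
    by (rule cinner_commute)
  also have "\<dots> = cnj (cinner h (unit_image \<Phi> j i (unit_image \<Phi> l k g)))"
    by (simp add: ct)
  also have "\<dots> = cinner (unit_image \<Phi> j i (unit_image \<Phi> l k g)) h"
    by (rule cinner_commute[symmetric])
  also have "\<dots> = cinner g (unit_image \<Phi> k l (unit_image \<Phi> i j h))"
    by (simp add: adj)
  finally show "cinner g (unit_image \<Phi> i j (unit_image \<Phi> k l h)) =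
      cinner g (unit_image \<Phi> k l (unit_image \<Phi> i j h))" .
qed (rule closure_UNIV)

lemma unit_image_word_op_commute:
  assumes "\<And>A. clinear (\<Phi> A)" and "fock_completion \<Phi> q" and "length u = length w"
  shows "unit_image \<Phi> i j (word_op \<Phi> u w h) = word_op \<Phi> u w (unit_image \<Phi> i j h)"
  using assms(3)
proof (induction u w rule: list_induct2)
  case (Cons a u b w)
  then show ?case
    by (simp add: unit_image_commute[OF assms(1,2), of i j])
qed simp


section \<open>Creation operators\<close>

lemma tensor_expansion:
  assumes "clinear q"
  shows "q x = (\<Sum>u\<in>Poly_Mapping.keys x. q (u \<otimes> Poly_Mapping.lookup x u))"
proof -
  have "x = (\<Sum>u\<in>Poly_Mapping.keys x. u \<otimes> Poly_Mapping.lookup x u)"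
    by (rule poly_mapping_eqI)
      (simp add: lookup_sum lookup_single when_def in_keys_iff)
  then have "q x = q (\<Sum>u\<in>Poly_Mapping.keys x. u \<otimes> Poly_Mapping.lookup x u)"
    by (rule arg_cong)
  also have "\<dots> = (\<Sum>u\<in>Poly_Mapping.keys x. q (u \<otimes> Poly_Mapping.lookup x u))"
    using assms unfolding Vector_Spaces.linear_def by (blast intro: module_hom.sum)
  finally show ?thesis .
qed

lemma prepend_letter_tensor [simp]: "prepend_letter i (w \<otimes> h) = (i # w) \<otimes> h"
  by (cases "h = 0") (simp_all add: prepend_letter_def)

lemma prepend_letter_expansion:
  assumes "clinear q"
  shows "q (prepend_letter i x) =
    (\<Sum>u\<in>Poly_Mapping.keys x. q ((i # u) \<otimes> Poly_Mapping.lookup x u))"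
  unfolding prepend_letter_def
  using assms unfolding Vector_Spaces.linear_def by (blast intro: module_hom.sum)

text \<open>On an elementary tensor \<open>u \<otimes> k\<close> in place of \<open>x\<close> the two sides carry \<open>unit_image \<Phi> i j\<close> on
  the left and on the right of \<open>word_op \<Phi> u w\<close>, so commutation makes them equal.\<close>

lemma cinner_prepend_letter:
  assumes "\<And>A. clinear (\<Phi> A)" and "fock_completion \<Phi> q"
  shows "cinner (q (prepend_letter i x)) (q ((j # w) \<otimes> h)) =
    cinner (q x) (q (w \<otimes> unit_image \<Phi> i j h))"
proof -
  have "clinear q"
    using assms(2) by (simp add: fock_completion_def)
  moreover have "cinner (q ((i # u) \<otimes> k)) (q ((j # w) \<otimes> h)) =
      cinner (q (u \<otimes> k)) (q (w \<otimes> unit_image \<Phi> i j h))" for u k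
    by (simp add: cinner_tensor[OF assms] unit_image_word_op_commute[OF assms])
  ultimately show ?thesis
    by (simp add: tensor_expansion[of q x] prepend_letter_expansion cinner_sum_left)
qed

text \<open>The difference of the two sides below is orthogonal to every \<open>q ((j # w) \<otimes> h)\<close>, and it is
  itself a sum of such vectors, so it is orthogonal to itself.\<close>

lemma prepend_letter_respects_classes:
  assumes "\<And>A. clinear (\<Phi> A)" and "fock_completion \<Phi> q" and "q x = q y"
  shows "q (prepend_letter i x) = q (prepend_letter i y)"
proof -
  define d where "d = q (prepend_letter i x) - q (prepend_letter i y)"
  have lin: "clinear q"
    using assms(2) by (simp add: fock_completion_def)
  have "cinner d (q ((j # w) \<otimes> h)) = 0" for j w h
    by (simp add: d_def cinner_diff_left cinner_prepend_letter[OF assms(1,2)] assms(3))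
  then have "cinner d (q (prepend_letter i z)) = 0" for z
    by (simp add: prepend_letter_expansion[OF lin] cinner_sum_right)
  then have "cinner d d = 0"
    by (subst (2) d_def) (simp add: cinner_diff_right)
  then show ?thesis
    by (simp add: d_def)
qed

lemma creation_apply:
  assumes "\<And>A. clinear (\<Phi> A)" and "fock_completion \<Phi> q"
  shows "creation q i (q x) = q (prepend_letter i x)"
  unfolding creation_def
  by (rule the_equality) (auto intro: prepend_letter_respects_classes[OF assms])

theorem theorem5p6:
  fixes \<Phi> :: "complex^'n^'n \<Rightarrow> 'h::complex_hilbert_space \<Rightarrow> 'h"
    and q :: "('n list \<Rightarrow>\<^sub>0 'h) \<Rightarrow> 'f::complex_hilbert_space"
    and w :: "'n list" and h :: 'h and i j :: 'n
  assumes "CARD('n) \<ge> 2"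
    and "completely_positive \<Phi>"
    and "fock_form_psd \<Phi>"
    and "fock_completion \<Phi> q"
  shows "creation q j (q (w \<otimes> h)) \<in> adjoint_domain (range q) (creation q i) \<and>
    adjoint_op (range q) (creation q i) (creation q j (q (w \<otimes> h))) =
      q (w \<otimes> unit_image \<Phi> i j h)"
proof -
  have lin: "clinear (\<Phi> A)" for A
    using assms(2) by (simp add: completely_positive_def bounded_clinear_def)
  have dense: "closure (range q) = UNIV"
    using assms(4) by (simp add: fock_completion_def)
  have "cinner (creation q i u) (creation q j (q (w \<otimes> h))) =
      cinner u (q (w \<otimes> unit_image \<Phi> i j h))" if "u \<in> range q" for u
    using that by (auto simp: creation_apply[OF lin assms(4)] cinner_prepend_letter[OF lin assms(4)])
  from adjoint_opI[OF dense this] show ?thesis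
    by simp
qed

end
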